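(* Let $f:\mathbb{R}^n\to\mathbb{R}$ be continuously differentiable with $L_f$-Lipschitz continuous gradient, let $g:\mathbb{R}^n\to\mathbb{R}\cup\{+\infty\}$ be proper, lower semicontinuous and convex, and assume that $f+g$ is bounded below. Let $\gamma>0$ and $\hat x\in\mathbb{R}^n$. Select $H\in\partial^2 f(\hat x)$ and $\mathcal{P}_\gamma\in\partial_C\operatorname{prox}_{\gamma g}(\hat x-\gamma\nabla f(\hat x))$, and set $\mathcal{Q}_\gamma:=I-\gamma H$ and $\mathcal{L}_\gamma:=\frac1\gamma\left(I-\mathcal{P}_\gamma\mathcal{Q}_\gamma\right)$. Suppose that $\mathcal{P}_\gamma^2=\mathcal{P}_\gamma$, and define $\mathcal{P}_\gamma^\perp:=I-\mathcal{P}_\gamma$. Then any solution $d^\star$ of the minimization problem $$\operatorname*{minimize}_{d\in\mathbb{R}^n}\ \tfrac12\langle d,Hd\rangle+\langle R_\gamma(\hat x),d\rangle\quad\text{subject to}\quad \mathcal{P}_\gamma^\perp d=-\gamma\,\mathcal{P}_\gamma^\perp R_\gamma(\hat x)$$ also solves the Newton system of the fixed-point residual, $$\mathcal{L}_\gamma\, d^\star=-R_\gamma(\hat x).$$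
   Context: For a function $h:\mathbb{R}^n\to\mathbb{R}\cup\{+\infty\}$, $\operatorname{prox}_h(x):=\operatorname{argmin}_u\{h(u)+\frac12\|u-x\|^2\}$ (single-valued when $h$ is proper, lower semicontinuous and convex). The forward-backward operator is $T_\gamma(x):=\operatorname{prox}_{\gamma g}(x-\gamma\nabla f(x))$ and the fixed-point residual is $R_\gamma(x):=\frac1\gamma(x-T_\gamma(x))$. $\partial_C F$ denotes the Clarke generalized Jacobian of a locally Lipschitz map $F$ (the convex hull of all limits of Jacobians of $F$ at points of differentiability converging to the given point), and $\partial^2 f:=\partial_C(\nabla f)$ is the generalized Hessian of $f$. $\langle\cdot,\cdot\rangle$ and $\|\cdot\|$ are the Euclidean inner product and norm. The matrix $\mathcal{L}_\gamma$ is an element of the linear Newton approximation $\hat\partial R_\gamma(\hat x)=\{\frac1\gamma(I-\mathcal P\mathcal Q): \mathcal P\in\partial_C\operatorname{prox}_{\gamma g}(\hat x-\gamma\nabla f(\hat x)),\ \mathcal Q\in I-\gamma\,\partial^2 f(\hat x)\}$ of $R_\gamma$. *)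

theory Defs
  imports "HOL-Analysis.Analysis"
begin

text \<open>
  Functions \<open>\<real>\<^sup>n \<rightarrow> \<real> \<union> {+\<infinity>}\<close> are maps into \<^typ>\<open>ereal\<close>; the value \<open>-\<infinity>\<close> is excluded
  by \<open>proper_fun\<close>.
\<close>

definition proper_fun :: "('a \<Rightarrow> ereal) \<Rightarrow> bool" where
  "proper_fun h \<longleftrightarrow> (\<forall>x. h x \<noteq> -\<infinity>) \<and> (\<exists>x. h x \<noteq> \<infinity>)"

definition lower_semicont :: "('a::topological_space \<Rightarrow> ereal) \<Rightarrow> bool" where
  "lower_semicont h \<longleftrightarrow> (\<forall>x. h x \<le> Liminf (at x) h)"

text \<open>
  The analogue of \<^const>\<open>convex_on\<close>. Since \<open>0 * \<infinity> = 0\<close> in \<^typ>\<open>ereal\<close>, the cases \<open>u = 0\<close>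
  and \<open>v = 0\<close> impose nothing; for functions avoiding \<open>-\<infinity>\<close> no sum \<open>\<infinity> + (-\<infinity>)\<close> occurs.
\<close>

definition convex_fun :: "('a::real_vector \<Rightarrow> ereal) \<Rightarrow> bool" where
  "convex_fun h \<longleftrightarrow>
     (\<forall>x y. \<forall>u\<ge>0. \<forall>v\<ge>0. u + v = 1 \<longrightarrow>
        h (u *\<^sub>R x + v *\<^sub>R y) \<le> ereal u * h x + ereal v * h y)"

definition gradient :: "('a::real_inner \<Rightarrow> real) \<Rightarrow> 'a \<Rightarrow> 'a" where
  "gradient f x = (THE D. GDERIV f x :> D)"

lemma gradient_eqI:
  assumes "GDERIV f x :> D"
  shows "gradient f x = D"
  unfolding gradient_def
proof (rule the_equality[where P = "\<lambda>D. GDERIV f x :> D", OF assms])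
  fix E
  assume "GDERIV f x :> E"
  then have "(\<lambda>h. inner h E) = (\<lambda>h. inner h D)"
    using assms unfolding gderiv_def by (rule has_derivative_unique)
  then have "inner (E - D) E = inner (E - D) D"
    by meson
  then show "E = D"
    by (metis eq_iff_diff_eq_0 inner_diff_right inner_eq_zero_iff)
qed

lemma GDERIV_gradient:
  fixes f :: "'a::euclidean_space \<Rightarrow> real"
  assumes "f differentiable (at x)"
  shows "GDERIV f x :> gradient f x"
proof -
  obtain f' where f': "(f has_derivative f') (at x)"
    using assms by (auto simp: differentiable_def)
  then interpret linear f'
    by (rule has_derivative_linear)
  have "f' = (\<lambda>h. inner h (adjoint f' 1))"
    using adjoint_works[OF linear_axioms] by auto
  then have "GDERIV f x :> adjoint f' 1"
    using f' by (simp add: gderiv_def)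
  then show ?thesis
    using gradient_eqI by metis
qed

text \<open>
  Specified only where a minimizer exists, and equal to the minimizer wherever it is unique,
  in particular for proper, lower semicontinuous and convex \<open>h\<close>.
\<close>

definition prox :: "('a::real_normed_vector \<Rightarrow> ereal) \<Rightarrow> 'a \<Rightarrow> 'a" where
  "prox h x = arg_min (\<lambda>u. h u + ereal (1/2 * (norm (u - x))\<^sup>2)) (\<lambda>_. True)"

definition fb_operator ::
    "('a::real_inner \<Rightarrow> real) \<Rightarrow> ('a \<Rightarrow> ereal) \<Rightarrow> real \<Rightarrow> 'a \<Rightarrow> 'a" where
  "fb_operator f g \<gamma> x = prox (\<lambda>u. ereal \<gamma> * g u) (x - \<gamma> *\<^sub>R gradient f x)"

definition fp_residual ::
    "('a::real_inner \<Rightarrow> real) \<Rightarrow> ('a \<Rightarrow> ereal) \<Rightarrow> real \<Rightarrow> 'a \<Rightarrow> 'a" where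
  "fp_residual f g \<gamma> x = (1 / \<gamma>) *\<^sub>R (x - fb_operator f g \<gamma> x)"

definition clarke_jacobian :: "(real^'n \<Rightarrow> real^'m) \<Rightarrow> real^'n \<Rightarrow> (real^'n^'m) set" where
  "clarke_jacobian F x = convex hull
     {A. \<exists>X. X \<longlonglongrightarrow> x \<and> (\<forall>k::nat. F differentiable (at (X k))) \<and>
             (\<lambda>k. jacobian F (at (X k))) \<longlonglongrightarrow> A}"

definition generalized_hessian :: "(real^'n \<Rightarrow> real) \<Rightarrow> real^'n \<Rightarrow> (real^'n^'n) set" where
  "generalized_hessian f = clarke_jacobian (gradient f)"

end

theory Submission
  imports Defs
begin

text \<open>
  Write \<open>R\<close> for the residual at \<open>xhat\<close>. The directions that respect the linear constraint are
  those in the range of \<open>P\<close>, so at a minimizer \<open>d\<close> the gradient of the objective is orthogonal to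
  that range. Two symmetries turn this into the Newton system. Because \<open>H\<close> is symmetric, the
  gradient is \<open>H d + R\<close>. Because \<open>P\<close> is symmetric, orthogonality to its range means
  \<open>P (H d + R) = 0\<close>. With the constraint \<open>d - P d = - \<gamma> (R - P R)\<close> this gives
  \<open>\<L> d = (d - P d) / \<gamma> + P H d = - (R - P R) - P R = - R\<close>.

  Each symmetry is a closed and convex condition on matrices, or follows from one, so it need only
  be checked on genuine Jacobians and then passes to the Clarke Jacobian
  (\<open>clarke_jacobian_subset\<close>).

  \<^item> For \<open>H\<close> the condition is symmetry itself. The derivative of a gradient field at a single point
    of differentiability is self-adjoint, because the second difference of \<open>f\<close> is symmetric in its
    two increments (\<open>derivative_of_gradient_selfadjoint\<close>).

  \<^item> For \<open>P\<close> the condition is to have operator norm at most 1, which the Jacobians of the proximal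
    map satisfy since that map is nonexpansive (\<open>prox_nonexpansive\<close>). An idempotent that does not
    increase norms is an orthogonal projection, hence symmetric
    (\<open>nonexpansive_idempotent_selfadjoint\<close>). This avoids exhibiting the proximal map as the
    gradient of a potential.

  As \<^const>\<open>prox\<close> is a choice of minimizer, nonexpansiveness rests on the existence of minimizers
  (\<open>prox_minimizes\<close>).
\<close>

section \<open>Self-adjointness of second derivatives\<close>

text \<open>
  The second difference is the increment over \<open>[0, h]\<close> of
  \<open>\<psi> t = f (x + h u + t v) - f (x + t v)\<close>. The mean value theorem turns it into
  \<open>h (v \<bullet> (G (x + h u + t v) - G (x + t v)))\<close>, and expanding both values of \<open>G\<close> around \<open>x\<close> leaves
  \<open>h\<^sup>2 (v \<bullet> A u)\<close> up to \<open>o(h\<^sup>2)\<close>. Differentiability of \<open>G\<close> at the single point \<open>x\<close> suffices, which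
  is all that points of differentiability of a merely Lipschitz gradient offer.
\<close>

lemma second_difference_estimate:
  fixes f :: "'a::real_inner \<Rightarrow> real"
  assumes grad: "\<And>x. GDERIV f x :> G x"
    and der: "(G has_derivative A) (at x)"
    and "e > 0"
  shows "eventually (\<lambda>h. \<bar>f (x + h *\<^sub>R u + h *\<^sub>R v) - f (x + h *\<^sub>R u) - f (x + h *\<^sub>R v) + f x
                         - h\<^sup>2 * (v \<bullet> A u)\<bar> \<le> e * h\<^sup>2) (at_right 0)"
proof -
  interpret A: bounded_linear A
    using der by (rule has_derivative_bounded_linear)
  \<comment> \<open>Chosen so that accuracy \<open>e / c\<close> in the expansion of \<open>G\<close>, used twice on increments of norm at
    most \<open>h (norm u + norm v + 1)\<close> and paired with \<open>v\<close>, costs \<open>e h\<close>; the summands 1 keep \<open>c\<close>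
    positive for zero increments.\<close>
  define c where "c = 2 * (norm u + norm v + 1) * (norm v + 1)"
  have "((\<lambda>t. z + t *\<^sub>R v) has_derivative (\<lambda>s. s *\<^sub>R v)) (at t)" for z and t :: real
    by (auto intro!: derivative_eq_intros)
  then have line: "((\<lambda>t. f (z + t *\<^sub>R v)) has_derivative (\<lambda>s. (s *\<^sub>R v) \<bullet> G (z + t *\<^sub>R v))) (at t)"
    for z and t :: real
    by (rule has_derivative_compose[OF _ grad[unfolded gderiv_def]])
  have npos: "norm u + norm v + 1 > 0" and "norm v + 1 > 0"
    by (simp_all add: add_nonneg_pos)
  then have "c > 0"
    by (simp add: c_def)
  then have "e / c > 0"
    using \<open>e > 0\<close> by simp
  then obtain d where "d > 0"
    and d: "\<And>y. norm (y - x) < d \<Longrightarrow> norm (G y - G x - A (y - x)) \<le> e / c * norm (y - x)"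
    using der unfolding has_derivative_at_alt by meson
  define r where "r = d / (norm u + norm v + 1)"
  have "r > 0"
    unfolding r_def using \<open>d > 0\<close> npos by simp
  have "\<bar>f (x + h *\<^sub>R u + h *\<^sub>R v) - f (x + h *\<^sub>R u) - f (x + h *\<^sub>R v) + f x
          - h\<^sup>2 * (v \<bullet> A u)\<bar> \<le> e * h\<^sup>2" if "0 < h" "h < r" for h
  proof -
    define \<psi> where "\<psi> t = f (x + h *\<^sub>R u + t *\<^sub>R v) - f (x + t *\<^sub>R v)" for t
    have "(\<psi> has_derivative
            (\<lambda>s. (s *\<^sub>R v) \<bullet> G (x + h *\<^sub>R u + t *\<^sub>R v) - (s *\<^sub>R v) \<bullet> G (x + t *\<^sub>R v))) (at t)" for t
      unfolding \<psi>_def by (intro has_derivative_diff line)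
    then have "\<exists>t\<in>{0<..<h}. \<psi> h - \<psi> 0
        = ((h - 0) *\<^sub>R v) \<bullet> G (x + h *\<^sub>R u + t *\<^sub>R v) - ((h - 0) *\<^sub>R v) \<bullet> G (x + t *\<^sub>R v)"
      by (rule mvt_simple[OF \<open>0 < h\<close> has_derivative_at_withinI])
    then obtain t where t: "0 < t" "t < h"
      and mv: "\<psi> h - \<psi> 0 = h * (v \<bullet> (G (x + h *\<^sub>R u + t *\<^sub>R v) - G (x + t *\<^sub>R v)))"
      by (auto simp: inner_diff_right algebra_simps)
    have est: "norm (G (x + w) - G x - A w) \<le> e / c * (h * (norm u + norm v + 1))"
      if "norm w \<le> h * (norm u + norm v)" for w
    proof -
      have le: "norm w \<le> h * (norm u + norm v + 1)"
        using that \<open>0 < h\<close> by (simp add: algebra_simps)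
      have "h * (norm u + norm v + 1) < d"
        using \<open>h < r\<close> npos unfolding r_def by (simp add: pos_less_divide_eq)
      then have "norm (G (x + w) - G x - A w) \<le> e / c * norm w"
        using d[of "x + w"] le by simp
      also have "\<dots> \<le> e / c * (h * (norm u + norm v + 1))"
        using le \<open>e / c > 0\<close> by (intro mult_left_mono) auto
      finally show ?thesis .
    qed
    have tv: "norm (t *\<^sub>R v) \<le> h * norm v"
      using t by (simp add: mult_right_mono)
    have n1: "norm (h *\<^sub>R u + t *\<^sub>R v) \<le> h * (norm u + norm v)"
      using norm_triangle_ineq[of "h *\<^sub>R u" "t *\<^sub>R v"] tv \<open>0 < h\<close> by (simp add: algebra_simps)
    have n2: "norm (t *\<^sub>R v) \<le> h * (norm u + norm v)"
      using tv \<open>0 < h\<close> by (simp add: distrib_left add_increasing)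
    define D where "D = (G (x + (h *\<^sub>R u + t *\<^sub>R v)) - G x - A (h *\<^sub>R u + t *\<^sub>R v))
                        - (G (x + t *\<^sub>R v) - G x - A (t *\<^sub>R v))"
    have D: "D = G (x + h *\<^sub>R u + t *\<^sub>R v) - G (x + t *\<^sub>R v) - h *\<^sub>R A u"
      unfolding D_def by (simp add: A.add A.scaleR add.assoc)
    have "norm D \<le> 2 * (e / c * (h * (norm u + norm v + 1)))"
      unfolding D_def using norm_triangle_ineq4 est[OF n1] est[OF n2] by (smt (verit))
    then have "\<bar>v \<bullet> D\<bar> \<le> norm v * (2 * (e / c * (h * (norm u + norm v + 1))))"
      using Cauchy_Schwarz_ineq2[of v D] by (meson mult_left_mono norm_ge_zero order_trans)
    also have "\<dots> \<le> (norm v + 1) * (2 * (e / c * (h * (norm u + norm v + 1))))"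
      using \<open>e > 0\<close> \<open>c > 0\<close> \<open>0 < h\<close> npos by (intro mult_right_mono mult_nonneg_nonneg) auto
    also have "\<dots> = e / c * h * c"
      unfolding c_def by (simp only: mult_ac)
    also have "\<dots> = e * h"
      using \<open>c > 0\<close> by simp
    finally have vD: "\<bar>v \<bullet> D\<bar> \<le> e * h" .
    have "f (x + h *\<^sub>R u + h *\<^sub>R v) - f (x + h *\<^sub>R u) - f (x + h *\<^sub>R v) + f x = \<psi> h - \<psi> 0"
      unfolding \<psi>_def by simp
    also have "\<dots> - h\<^sup>2 * (v \<bullet> A u) = h * (v \<bullet> D)"
      unfolding mv D by (simp add: inner_diff_right algebra_simps power2_eq_square)
    finally have "\<bar>f (x + h *\<^sub>R u + h *\<^sub>R v) - f (x + h *\<^sub>R u) - f (x + h *\<^sub>R v) + f x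
                    - h\<^sup>2 * (v \<bullet> A u)\<bar> = h * \<bar>v \<bullet> D\<bar>"
      using \<open>0 < h\<close> by (simp add: abs_mult)
    also have "\<dots> \<le> h * (e * h)"
      using vD \<open>0 < h\<close> by (intro mult_left_mono) auto
    finally show ?thesis
      by (simp add: power2_eq_square mult_ac)
  qed
  then show ?thesis
    unfolding eventually_at_right_field using \<open>r > 0\<close> by auto
qed

text \<open>
  The second difference is unchanged when \<open>u\<close> and \<open>v\<close> are swapped, so both bilinear values are the
  limit of the same quotient.
\<close>

proposition derivative_of_gradient_selfadjoint:
  fixes f :: "'a::real_inner \<Rightarrow> real"
  assumes grad: "\<And>x. GDERIV f x :> G x"
    and der: "(G has_derivative A) (at x)"
  shows "v \<bullet> A u = u \<bullet> A v"
proof -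
  have "\<bar>v \<bullet> A u - u \<bullet> A v\<bar> \<le> e" if "e > 0" for e
  proof -
    have "e / 2 > 0"
      using that by simp
    have "eventually (\<lambda>h::real. h > 0) (at_right 0)"
      by (simp add: eventually_at_right_less)
    with second_difference_estimate[OF grad der \<open>e / 2 > 0\<close>, of u v]
      second_difference_estimate[OF grad der \<open>e / 2 > 0\<close>, of v u]
    have "eventually (\<lambda>h::real. \<bar>v \<bullet> A u - u \<bullet> A v\<bar> \<le> e) (at_right 0)"
    proof eventually_elim
      case (elim h)
      have swap: "x + h *\<^sub>R v + h *\<^sub>R u = x + h *\<^sub>R u + h *\<^sub>R v"
        by (simp add: algebra_simps)
      have "\<bar>h\<^sup>2 * (v \<bullet> A u) - h\<^sup>2 * (u \<bullet> A v)\<bar> \<le> e * h\<^sup>2"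
        using elim(1) elim(2)[unfolded swap] by linarith
      then have "h\<^sup>2 * \<bar>v \<bullet> A u - u \<bullet> A v\<bar> \<le> h\<^sup>2 * e"
        by (simp only: right_diff_distrib[symmetric] abs_mult abs_power2 mult.commute[of e])
      with elim(3) show ?case
        by simp
    qed
    then show ?thesis
      by (simp add: eventually_const)
  qed
  then have "\<bar>v \<bullet> A u - u \<bullet> A v\<bar> \<le> 0"
    by (rule field_le_epsilon[where y = 0, simplified])
  then show ?thesis
    by simp
qed

section \<open>Elements of Clarke Jacobians\<close>

text \<open>
  Closedness absorbs the limits of Jacobians and convexity the hull, so a property defining a closed
  convex set of matrices need only be checked where \<open>F\<close> is differentiable.
\<close>

lemma clarke_jacobian_subset:
  assumes "convex S" "closed S"
    and "\<And>y. F differentiable (at y) \<Longrightarrow> jacobian F (at y) \<in> S"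
  shows "clarke_jacobian F x \<subseteq> S"
  unfolding clarke_jacobian_def
proof (rule hull_minimal)
  show "{A. \<exists>X. X \<longlonglongrightarrow> x \<and> (\<forall>k::nat. F differentiable (at (X k))) \<and>
             (\<lambda>k. jacobian F (at (X k))) \<longlonglongrightarrow> A} \<subseteq> S"
  proof safe
    fix A X
    assume diff: "\<forall>k. F differentiable (at (X k))"
      and lim: "(\<lambda>k. jacobian F (at (X k))) \<longlonglongrightarrow> A"
    show "A \<in> S"
      by (rule closed_sequentially[OF assms(2) _ lim]) (rule assms(3)[OF diff[rule_format]])
  qed
qed (rule assms(1))

lemma bounded_linear_matrix_vector_mult_left:
  "bounded_linear (\<lambda>A::real^'n^'m. A *v v)"
proof -
  have "linear (\<lambda>A::real^'n^'m. A *v v)"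
    by (rule linearI) (simp_all only: matrix_vector_mult_add_rdistrib scaleR_matrix_vector_assoc)
  then show ?thesis
    by (rule linear_conv_bounded_linear[THEN iffD1])
qed

proposition generalized_hessian_selfadjoint:
  fixes f :: "real^'n \<Rightarrow> real"
  assumes "\<And>x. f differentiable (at x)"
    and "H \<in> generalized_hessian f x"
  shows "u \<bullet> (H *v v) = v \<bullet> (H *v u)"
proof -
  define S where "S = {A :: real^'n^'n. \<forall>u v. u \<bullet> (A *v v) = v \<bullet> (A *v u)}"
  have "convex S"
    unfolding convex_def S_def
    by (simp add: matrix_vector_mult_add_rdistrib inner_add_right
        flip: scaleR_matrix_vector_assoc)
  moreover have "closed S"
    unfolding S_def
    by (intro closed_Collect_all closed_Collect_eq continuous_on_inner continuous_on_const
        linear_continuous_on bounded_linear_matrix_vector_mult_left)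
  moreover have "jacobian (gradient f) (at y) \<in> S" if "gradient f differentiable (at y)" for y
    unfolding S_def
    using derivative_of_gradient_selfadjoint[OF GDERIV_gradient[OF assms(1)]
        that[unfolded jacobian_works]]
    by blast
  ultimately have "clarke_jacobian (gradient f) x \<subseteq> S"
    by (rule clarke_jacobian_subset)
  then show ?thesis
    using assms(2) unfolding generalized_hessian_def S_def by blast
qed

lemma norm_derivative_le:
  fixes F :: "'a::real_normed_vector \<Rightarrow> 'b::real_normed_vector"
  assumes lip: "L-lipschitz_on UNIV F"
    and der: "(F has_derivative F') (at x)"
  shows "norm (F' v) \<le> L * norm v"
proof -
  interpret F': bounded_linear F'
    using der by (rule has_derivative_bounded_linear)
  show ?thesis
  proof (rule field_le_epsilon)
    fix e :: real
    assume "e > 0"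
    then have "e / (norm v + 1) > 0"
      by (simp add: add_nonneg_pos)
    then obtain d where "d > 0"
      and d: "\<And>y. norm (y - x) < d \<Longrightarrow>
                norm (F y - F x - F' (y - x)) \<le> e / (norm v + 1) * norm (y - x)"
      using der unfolding has_derivative_at_alt by meson
    define t where "t = d / (norm v + 1)"
    have "t > 0"
      using \<open>d > 0\<close> by (simp add: t_def add_nonneg_pos)
    have "t * norm v < t * (norm v + 1)"
      using \<open>t > 0\<close> by simp
    also have "\<dots> = d"
      by (simp add: t_def add_nonneg_eq_0_iff)
    finally have "norm (F (x + t *\<^sub>R v) - F x - t *\<^sub>R F' v) \<le> e / (norm v + 1) * (t * norm v)"
      using d[of "x + t *\<^sub>R v"] \<open>t > 0\<close> by (simp add: F'.scaleR)
    also have "\<dots> = t * (e * (norm v / (norm v + 1)))"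
      by simp
    also have "\<dots> \<le> t * e"
      using \<open>t > 0\<close> \<open>e > 0\<close> by (simp add: divide_le_eq add_nonneg_pos)
    finally have "norm (F (x + t *\<^sub>R v) - F x - t *\<^sub>R F' v) \<le> t * e" .
    moreover have "norm (F (x + t *\<^sub>R v) - F x) \<le> L * (t * norm v)"
      using lipschitz_onD[OF lip, of "x + t *\<^sub>R v" x] \<open>t > 0\<close> by (simp add: dist_norm)
    ultimately have "norm (t *\<^sub>R F' v) \<le> L * (t * norm v) + t * e"
      using norm_triangle_ineq4[of "F (x + t *\<^sub>R v) - F x"
          "F (x + t *\<^sub>R v) - F x - t *\<^sub>R F' v"] by simp
    then have "t * norm (F' v) \<le> t * (L * norm v + e)"
      using \<open>t > 0\<close> by (simp add: algebra_simps)
    then show "norm (F' v) \<le> L * norm v + e"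
      using \<open>t > 0\<close> by simp
  qed
qed

proposition clarke_jacobian_norm_le:
  fixes F :: "real^'n \<Rightarrow> real^'m"
  assumes "L-lipschitz_on UNIV F"
    and "A \<in> clarke_jacobian F x"
  shows "norm (A *v v) \<le> L * norm v"
proof -
  define S where "S = {A :: real^'n^'m. \<forall>v. norm (A *v v) \<le> L * norm v}"
  have S_eq: "S = (\<Inter>v. (\<lambda>A. A *v v) -` cball 0 (L * norm v))"
    unfolding S_def by auto
  have "convex S"
    unfolding S_eq
    by (intro convex_INT ballI convex_linear_vimage convex_cball
        bounded_linear.linear bounded_linear_matrix_vector_mult_left)
  moreover have "closed S"
    unfolding S_def
    by (intro closed_Collect_all closed_Collect_le continuous_on_norm continuous_on_const
        linear_continuous_on bounded_linear_matrix_vector_mult_left)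
  moreover have "jacobian F (at y) \<in> S" if "F differentiable (at y)" for y
    unfolding S_def
    using norm_derivative_le[OF assms(1) that[unfolded jacobian_works]] by blast
  ultimately have "clarke_jacobian F x \<subseteq> S"
    by (rule clarke_jacobian_subset)
  then show ?thesis
    using assms(2) unfolding S_def by blast
qed

section \<open>The proximal map is nonexpansive\<close>

lemma lower_semicont_open_superlevel:
  assumes "lower_semicont h"
  shows "open {x. c < h x}"
proof -
  have "\<exists>S. open S \<and> x \<in> S \<and> S \<subseteq> {x. c < h x}" if "c < h x" for x
  proof -
    have "eventually (\<lambda>y. c < h y) (at x)"
      using assms that unfolding lower_semicont_def
      by (intro less_LiminfD) (blast intro: less_le_trans)
    then have "eventually (\<lambda>y. c < h y) (nhds x)"
      using that by (simp add: eventually_nhds_conv_at)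
    then show ?thesis
      unfolding eventually_nhds by blast
  qed
  then show ?thesis
    by (subst open_subopen) blast
qed

text \<open>
  If no point of \<open>K\<close> were a minimizer, the open sets \<open>{x. h y < h x}\<close> with \<open>y \<in> K\<close> would cover
  \<open>K\<close>. Among the finitely many \<open>y\<close> of a subcover, the one with least value lies in none of
  the sets.
\<close>

lemma lower_semicont_attains_inf:
  assumes "lower_semicont h" "compact K" "K \<noteq> {}"
  shows "\<exists>x\<in>K. \<forall>y\<in>K. h x \<le> h y"
proof (rule ccontr)
  assume "\<not> ?thesis"
  then have "K \<subseteq> (\<Union>y\<in>K. {x. h y < h x})"
    by (force simp: not_le)
  then obtain Y where Y: "Y \<subseteq> K" "finite Y" "K \<subseteq> (\<Union>y\<in>Y. {x. h y < h x})"
    using compactE_image[OF assms(2)] lower_semicont_open_superlevel[OF assms(1)] by metis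
  then have "Y \<noteq> {}"
    using assms(3) by auto
  then obtain y where "y \<in> Y" "\<And>z. z \<in> Y \<Longrightarrow> h y \<le> h z"
    using Y(2) ex_min_if_finite[of "h ` Y"] by (auto simp: not_less)
  then show False
    using Y(1,3) by (force simp: not_le[symmetric])
qed

lemma lower_semicont_add_continuous:
  fixes h :: "'a::topological_space \<Rightarrow> ereal"
  assumes "lower_semicont h" "continuous_on UNIV q" "\<And>x. h x \<noteq> -\<infinity>"
  shows "lower_semicont (\<lambda>x. h x + ereal (q x))"
  unfolding lower_semicont_def le_Liminf_iff
proof (intro allI impI)
  fix x c
  assume c: "c < h x + ereal (q x)"
  show "eventually (\<lambda>y. c < h y + ereal (q y)) (at x)"
  proof (cases c)
    case MInf
    then show ?thesis
      using assms(3) by (intro always_eventually) (auto simp: less_le)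
  next
    case PInf
    with c show ?thesis by simp
  next
    case (real r)
    then have "ereal (r - q x) < h x"
      using c by (cases "h x") auto
    then obtain s where s: "ereal (r - q x) < ereal s" "ereal s < h x"
      using ereal_dense2 by blast
    have "eventually (\<lambda>y. ereal s < h y) (at x)"
      using assms(1) s(2) unfolding lower_semicont_def
      by (intro less_LiminfD) (blast intro: less_le_trans)
    moreover have "(q \<longlongrightarrow> q x) (at x)"
      using assms(2) by (simp add: continuous_on_def)
    then have "eventually (\<lambda>y. r - s < q y) (at x)"
      using s(1) by (intro order_tendstoD(1)) auto
    ultimately show ?thesis
    proof eventually_elim
      case (elim y)
      then show ?case
        using real by (cases "h y") auto
    qed
  qed
qed

text \<open>
  A substitute for an affine minorant that requires no separation theorem. On the unit ball around
  \<open>x\<^sub>0\<close> the function is bounded below by its minimum \<open>c\<close>. A point \<open>u\<close> farther away is handled by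
  convexity along the segment from \<open>x\<^sub>0\<close>: where the segment crosses the unit sphere the value is at
  least \<open>c\<close>, so \<open>h\<close> cannot decrease faster than with slope \<open>a - c\<close> beyond.
\<close>

lemma convex_fun_conical_minorant:
  fixes h :: "'a::euclidean_space \<Rightarrow> ereal"
  assumes "proper_fun h" "lower_semicont h" "convex_fun h" "h x\<^sub>0 = ereal a"
  obtains c k where "k \<ge> 0" "\<And>u. ereal (c - k * norm (u - x\<^sub>0)) \<le> h u"
proof -
  have ninf: "h u \<noteq> -\<infinity>" for u
    using assms(1) by (simp add: proper_fun_def)
  obtain z where z: "\<And>y. y \<in> cball x\<^sub>0 1 \<Longrightarrow> h z \<le> h y"
    using lower_semicont_attains_inf[OF assms(2) compact_cball, of x\<^sub>0 1]
    by (metis cball_eq_empty less_le_not_le zero_le_one)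
  have "h z \<le> ereal a"
    using z[of x\<^sub>0] assms(4) by simp
  with ninf[of z] obtain c where c: "h z = ereal c"
    by (cases "h z") auto
  have "c \<le> a"
    using \<open>h z \<le> ereal a\<close> c by simp
  have "ereal (c - (a - c) * norm (u - x\<^sub>0)) \<le> h u" for u
  proof (cases "h u")
    case PInf
    then show ?thesis by simp
  next
    case MInf
    with ninf show ?thesis by blast
  next
    case (real b)
    define s where "s = norm (u - x\<^sub>0)"
    show ?thesis
    proof (cases "s \<le> 1")
      case True
      then have "u \<in> cball x\<^sub>0 1"
        by (simp add: s_def dist_norm norm_minus_commute)
      then have "c \<le> b"
        using z[of u] c real by simp
      moreover have "(a - c) * s \<ge> 0"
        using \<open>c \<le> a\<close> by (simp add: s_def)
      ultimately show ?thesis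
        using real by (simp add: s_def)
    next
      case False
      then have "s > 1" by simp
      define y where "y = (1 - 1/s) *\<^sub>R x\<^sub>0 + (1/s) *\<^sub>R u"
      have "y - x\<^sub>0 = (1/s) *\<^sub>R (u - x\<^sub>0)"
        unfolding y_def by (simp add: algebra_simps)
      then have "norm (y - x\<^sub>0) = 1"
        using \<open>s > 1\<close> by (auto simp: s_def)
      then have "h z \<le> h y"
        by (intro z) (simp add: dist_norm norm_minus_commute)
      also have "h y \<le> ereal (1 - 1/s) * h x\<^sub>0 + ereal (1/s) * h u"
        using assms(3) \<open>s > 1\<close> unfolding convex_fun_def y_def by simp
      finally have "c \<le> (1 - 1/s) * a + (1/s) * b"
        using c real assms(4) by simp
      then have "s * c \<le> s * ((1 - 1/s) * a + (1/s) * b)"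
        using \<open>s > 1\<close> by (intro mult_left_mono) auto
      also have "\<dots> = s * a - a + b"
        using \<open>s > 1\<close> by (simp add: field_simps)
      finally have "c - (a - c) * s \<le> b"
        using \<open>c \<le> a\<close> by (simp add: algebra_simps)
      then show ?thesis
        using real by (simp add: s_def)
    qed
  qed
  then show thesis
    using that[of "a - c" c] \<open>c \<le> a\<close> by simp
qed

text \<open>
  The quadratic term outgrows the at most linear decay of \<open>h\<close>, so outside a large ball around \<open>x\<close>
  the objective exceeds its value at a point where \<open>h\<close> is finite; inside the ball the minimum is
  attained by compactness.
\<close>

proposition prox_minimizes:
  fixes h :: "'a::euclidean_space \<Rightarrow> ereal"
  assumes "proper_fun h" "lower_semicont h" "convex_fun h"
  shows "h (prox h x) + ereal (1/2 * (norm (prox h x - x))\<^sup>2)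
          \<le> h u + ereal (1/2 * (norm (u - x))\<^sup>2)"
proof -
  define \<phi> where "\<phi> u = h u + ereal (1/2 * (norm (u - x))\<^sup>2)" for u
  have ninf: "h u \<noteq> -\<infinity>" for u
    using assms(1) by (simp add: proper_fun_def)
  obtain x\<^sub>0 where "h x\<^sub>0 \<noteq> \<infinity>"
    using assms(1) by (auto simp: proper_fun_def)
  with ninf[of x\<^sub>0] obtain a where a: "h x\<^sub>0 = ereal a"
    by (cases "h x\<^sub>0") auto
  obtain c k where "k \<ge> 0" and minor: "\<And>u. ereal (c - k * norm (u - x\<^sub>0)) \<le> h u"
    using convex_fun_conical_minorant[OF assms a] by metis
  define D where "D = norm (x\<^sub>0 - x)"
  \<comment> \<open>With \<open>s = norm (u - x)\<close>, the minorant yields \<open>\<phi> x\<^sub>0 \<le> \<phi> u\<close> as soon as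
    \<open>B \<le> s\<^sup>2 / 2 - k s\<close>, which the second argument of the maximum below guarantees; the first one
    puts \<open>x\<^sub>0\<close> into the ball.\<close>
  define B where "B = a + D\<^sup>2 / 2 - c + k * D"
  define R where "R = max D (2 * k + \<bar>B\<bar> + 2)"
  have far: "\<phi> x\<^sub>0 \<le> \<phi> u" if "u \<notin> cball x R" for u
  proof -
    define s where "s = norm (u - x)"
    have s: "s > 2 * k + \<bar>B\<bar> + 2"
      using that by (auto simp: s_def R_def dist_norm norm_minus_commute)
    have "(\<bar>B\<bar> + 2) * 1 \<le> (s - 2 * k) * (s / 2)"
      using s \<open>k \<ge> 0\<close> by (intro mult_mono) auto
    then have "B \<le> s\<^sup>2 / 2 - k * s"
      by (simp add: algebra_simps power2_eq_square)
    moreover have "norm (u - x\<^sub>0) \<le> s + D"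
      using norm_triangle_ineq4[of "u - x" "x\<^sub>0 - x"] by (simp add: s_def D_def)
    then have "k * norm (u - x\<^sub>0) \<le> k * s + k * D"
      using \<open>k \<ge> 0\<close> by (metis distrib_left mult_left_mono)
    ultimately have "a + D\<^sup>2 / 2 \<le> c - k * norm (u - x\<^sub>0) + s\<^sup>2 / 2"
      unfolding B_def by simp
    then have "\<phi> x\<^sub>0 \<le> ereal (c - k * norm (u - x\<^sub>0)) + ereal (1/2 * (norm (u - x))\<^sup>2)"
      by (simp add: \<phi>_def a D_def s_def)
    also have "\<dots> \<le> \<phi> u"
      unfolding \<phi>_def using minor by (rule add_right_mono)
    finally show ?thesis .
  qed
  have "lower_semicont \<phi>"
    unfolding \<phi>_def using assms(2) ninf
    by (intro lower_semicont_add_continuous continuous_intros)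
  moreover have x0: "x\<^sub>0 \<in> cball x R"
    by (simp add: R_def D_def dist_norm norm_minus_commute)
  ultimately obtain p where "p \<in> cball x R" and p: "\<And>y. y \<in> cball x R \<Longrightarrow> \<phi> p \<le> \<phi> y"
    using lower_semicont_attains_inf[of \<phi> "cball x R"] by fastforce
  then have "\<phi> p \<le> \<phi> u" for u
    using far x0 order_trans by blast
  then have "\<phi> (arg_min \<phi> (\<lambda>_. True)) \<le> \<phi> u" for u
    by (metis arg_min_equality)
  then show ?thesis
    unfolding prox_def \<phi>_def by blast
qed

text \<open>
  The second claim says that \<open>x - prox h x\<close> is a subgradient of \<open>h\<close> at \<open>prox h x\<close>. It is the
  first-order form of minimality: move from \<open>prox h x\<close> a fraction \<open>t\<close> of the way towards \<open>u\<close>,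
  bound \<open>h\<close> there by convexity, divide by \<open>t\<close> and let \<open>t\<close> tend to 0.
\<close>

proposition prox_variational_inequality:
  fixes h :: "'a::euclidean_space \<Rightarrow> ereal"
  assumes "proper_fun h" "lower_semicont h" "convex_fun h"
  shows "h (prox h x) \<noteq> \<infinity>"
    and "h (prox h x) + ereal ((x - prox h x) \<bullet> (u - prox h x)) \<le> h u"
proof -
  define p where "p = prox h x"
  have ninf: "h u \<noteq> -\<infinity>" for u
    using assms(1) by (simp add: proper_fun_def)
  have min: "h p + ereal (1/2 * (norm (p - x))\<^sup>2) \<le> h u + ereal (1/2 * (norm (u - x))\<^sup>2)" for u
    unfolding p_def by (rule prox_minimizes[OF assms])
  obtain x\<^sub>0 where x0: "h x\<^sub>0 \<noteq> \<infinity>"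
    using assms(1) by (auto simp: proper_fun_def)
  then have "h p \<noteq> \<infinity>"
    using min[of x\<^sub>0] by auto
  then show "h (prox h x) \<noteq> \<infinity>"
    by (simp add: p_def)
  obtain a where a: "h p = ereal a"
    using \<open>h p \<noteq> \<infinity>\<close> ninf[of p] by (cases "h p") auto
  show "h (prox h x) + ereal ((x - prox h x) \<bullet> (u - prox h x)) \<le> h u"
  proof (cases "h u")
    case PInf
    then show ?thesis by simp
  next
    case MInf
    with ninf show ?thesis by blast
  next
    case (real b)
    define w where "w = u - p"
    have ineq: "(x - p) \<bullet> w \<le> b - a + t * ((norm w)\<^sup>2 / 2)" if "0 < t" "t \<le> 1" for t
    proof -
      have "(1 - t) *\<^sub>R p + t *\<^sub>R u = p + t *\<^sub>R w"
        unfolding w_def by (simp add: algebra_simps)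
      moreover have "h ((1 - t) *\<^sub>R p + t *\<^sub>R u) \<le> ereal (1 - t) * h p + ereal t * h u"
        using assms(3) that unfolding convex_fun_def by simp
      ultimately have "h (p + t *\<^sub>R w) \<le> ereal ((1 - t) * a + t * b)"
        by (simp add: a real)
      then have "h (p + t *\<^sub>R w) + ereal (1/2 * (norm (p + t *\<^sub>R w - x))\<^sup>2)
          \<le> ereal ((1 - t) * a + t * b) + ereal (1/2 * (norm (p + t *\<^sub>R w - x))\<^sup>2)"
        by (rule add_right_mono)
      with min[of "p + t *\<^sub>R w"]
      have "ereal a + ereal (1/2 * (norm (p - x))\<^sup>2)
          \<le> ereal ((1 - t) * a + t * b) + ereal (1/2 * (norm (p + t *\<^sub>R w - x))\<^sup>2)"
        unfolding a by (rule order_trans)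
      moreover have "(norm (p + t *\<^sub>R w - x))\<^sup>2
          = (norm (p - x))\<^sup>2 - 2 * t * ((x - p) \<bullet> w) + t\<^sup>2 * (norm w)\<^sup>2"
        unfolding power2_norm_eq_inner
        by (simp add: inner_diff_left inner_diff_right inner_add_left inner_add_right
            inner_commute algebra_simps power2_eq_square)
      ultimately have "t * ((x - p) \<bullet> w) \<le> t * (b - a + t * ((norm w)\<^sup>2 / 2))"
        by (simp add: algebra_simps power2_eq_square)
      then show ?thesis
        using \<open>0 < t\<close> by simp
    qed
    have "((\<lambda>t. b - a + t * ((norm w)\<^sup>2 / 2)) \<longlongrightarrow> b - a + 0 * ((norm w)\<^sup>2 / 2)) (at_right 0)"
      by (intro tendsto_intros)
    moreover have "eventually (\<lambda>t. (x - p) \<bullet> w \<le> b - a + t * ((norm w)\<^sup>2 / 2)) (at_right 0)"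
      unfolding eventually_at_right_field using ineq by (intro exI[of _ 1]) simp
    ultimately have "(x - p) \<bullet> w \<le> b - a + 0 * ((norm w)\<^sup>2 / 2)"
      by (intro tendsto_lowerbound) auto
    then show ?thesis
      using a real by (simp add: p_def w_def)
  qed
qed

text \<open>
  Adding the subgradient inequalities at \<open>p = prox h x\<close> and \<open>q = prox h y\<close>, each tested at the
  other point, cancels the values of \<open>h\<close> and leaves \<open>(norm (p - q))\<^sup>2 \<le> (x - y) \<bullet> (p - q)\<close>.
\<close>

proposition prox_nonexpansive:
  fixes h :: "'a::euclidean_space \<Rightarrow> ereal"
  assumes "proper_fun h" "lower_semicont h" "convex_fun h"
  shows "1-lipschitz_on UNIV (prox h)"
proof (rule lipschitz_onI)
  fix x y
  define p q where "p = prox h x" and "q = prox h y"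
  have ninf: "h u \<noteq> -\<infinity>" for u
    using assms(1) by (simp add: proper_fun_def)
  obtain a where a: "h p = ereal a"
    using prox_variational_inequality(1)[OF assms, of x] ninf[of p]
    by (cases "h p") (auto simp: p_def)
  obtain b where b: "h q = ereal b"
    using prox_variational_inequality(1)[OF assms, of y] ninf[of q]
    by (cases "h q") (auto simp: q_def)
  have "a + (x - p) \<bullet> (q - p) \<le> b" "b + (y - q) \<bullet> (p - q) \<le> a"
    using prox_variational_inequality(2)[OF assms, of x q]
      prox_variational_inequality(2)[OF assms, of y p] a b
    by (auto simp: p_def q_def)
  then have "(p - q) \<bullet> (p - q) \<le> (x - y) \<bullet> (p - q)"
    by (simp add: inner_diff_left inner_diff_right inner_commute)
  also have "\<dots> \<le> norm (x - y) * norm (p - q)"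
    by (rule norm_cauchy_schwarz)
  finally have "norm (p - q) * norm (p - q) \<le> norm (x - y) * norm (p - q)"
    by (simp flip: power2_norm_eq_inner power2_eq_square)
  then have "norm (p - q) \<le> norm (x - y)"
    by (cases "p = q") auto
  then show "dist (prox h x) (prox h y) \<le> 1 * dist x y"
    by (simp add: p_def q_def dist_norm)
qed simp

lemma proper_fun_scale:
  assumes "proper_fun g" "\<gamma> > 0"
  shows "proper_fun (\<lambda>u. ereal \<gamma> * g u)"
  using assms unfolding proper_fun_def by (auto simp: ereal_mult_eq_PInfty ereal_mult_eq_MInfty)

lemma lower_semicont_scale:
  fixes g :: "'a::perfect_space \<Rightarrow> ereal"
  assumes "lower_semicont g" "\<gamma> > 0"
  shows "lower_semicont (\<lambda>u. ereal \<gamma> * g u)"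
  using assms unfolding lower_semicont_def
  by (simp add: Liminf_ereal_mult_left ereal_mult_left_mono)

lemma convex_fun_scale:
  assumes "convex_fun g" "\<gamma> > 0"
  shows "convex_fun (\<lambda>u. ereal \<gamma> * g u)"
  unfolding convex_fun_def
proof (intro allI impI)
  fix x y and u v :: real
  assume "u \<ge> 0" "v \<ge> 0" "u + v = 1"
  then have "ereal \<gamma> * g (u *\<^sub>R x + v *\<^sub>R y) \<le> ereal \<gamma> * (ereal u * g x + ereal v * g y)"
    using assms unfolding convex_fun_def by (intro ereal_mult_left_mono) auto
  also have "\<dots> = ereal u * (ereal \<gamma> * g x) + ereal v * (ereal \<gamma> * g y)"
    using assms(2) by (simp add: ereal_pos_distrib mult.left_commute)
  finally show "ereal \<gamma> * g (u *\<^sub>R x + v *\<^sub>R y)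
      \<le> ereal u * (ereal \<gamma> * g x) + ereal v * (ereal \<gamma> * g y)" .
qed

section \<open>Nonexpansive idempotents and quadratic programs\<close>

text \<open>
  First-order optimality at \<open>t = 0\<close>, used both for the projection below and for the quadratic
  program.
\<close>

lemma linear_coefficient_zero:
  fixes a b :: real
  assumes "\<And>t. 0 \<le> t * a + t\<^sup>2 * b"
  shows "a = 0"
proof -
  \<comment> \<open>A step \<open>t = - s a\<close> against the slope, short enough that the quadratic term cannot
    compensate the decrease.\<close>
  define s where "s = 1 / (\<bar>b\<bar> + 1)"
  have "s > 0" "s * b < 1"
    unfolding s_def by (auto simp: field_simps)
  have "0 \<le> (- (s * a)) * a + (- (s * a))\<^sup>2 * b"
    by (rule assms)
  also have "\<dots> = (s * a\<^sup>2) * (s * b - 1)"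
    by (simp add: algebra_simps power2_eq_square)
  finally have "s * a\<^sup>2 \<le> 0"
    using \<open>s * b < 1\<close> by (simp add: zero_le_mult_iff)
  then show ?thesis
    using \<open>s > 0\<close> by (simp add: mult_le_0_iff)
qed

text \<open>
  The range of \<open>P\<close> is orthogonal to its kernel: for \<open>k\<close> in the kernel, \<open>P\<close> maps \<open>P u + t k\<close> back to
  \<open>P u\<close>, so \<open>norm (P u) \<le> norm (P u + t k)\<close> for every \<open>t\<close> of either sign, which forces
  \<open>P u \<bullet> k = 0\<close>. As \<open>w - P w\<close> lies in the kernel, \<open>P x \<bullet> y\<close> and \<open>x \<bullet> P y\<close> both equal
  \<open>P x \<bullet> P y\<close>.
\<close>

lemma nonexpansive_idempotent_selfadjoint:
  fixes P :: "'a::real_inner \<Rightarrow> 'a"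
  assumes "linear P" and idem: "\<And>v. P (P v) = P v" and nonexp: "\<And>v. norm (P v) \<le> norm v"
  shows "P x \<bullet> y = x \<bullet> P y"
proof -
  interpret linear P by fact
  have expand: "(norm (a + t *\<^sub>R b))\<^sup>2
      = (norm a)\<^sup>2 + 2 * (t * (a \<bullet> b)) + t\<^sup>2 * (norm b)\<^sup>2" for a b :: 'a and t :: real
    using inner_commute[of b a]
    by (simp add: power2_norm_eq_inner inner_add_left inner_add_right algebra_simps)
       (simp add: power2_eq_square)
  have orth: "P u \<bullet> (w - P w) = 0" for u w
  proof (rule linear_coefficient_zero[where b = "(norm (w - P w))\<^sup>2 / 2"])
    fix t :: real
    have "P (P u + t *\<^sub>R (w - P w)) = P u"
      by (simp add: add scale diff idem)
    then have "norm (P u) \<le> norm (P u + t *\<^sub>R (w - P w))"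
      using nonexp by metis
    then have "(norm (P u))\<^sup>2 \<le> (norm (P u + t *\<^sub>R (w - P w)))\<^sup>2"
      by (rule power_mono) simp
    also have "\<dots> = (norm (P u))\<^sup>2 + 2 * (t * (P u \<bullet> (w - P w))) + t\<^sup>2 * (norm (w - P w))\<^sup>2"
      by (rule expand)
    finally show "0 \<le> t * (P u \<bullet> (w - P w)) + t\<^sup>2 * ((norm (w - P w))\<^sup>2 / 2)"
      by simp
  qed
  show ?thesis
    using orth[of x y] orth[of y x] by (simp add: inner_diff_right inner_commute)
qed

text \<open>
  Symmetry of \<open>H\<close> enters because the derivative of \<open>1/2 (d \<bullet> H d)\<close> is given by the symmetric part
  of \<open>H\<close> alone.
\<close>

lemma quadratic_minimizer_stationary:
  fixes H :: "real^'n^'n"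
  assumes sym: "\<And>u v. u \<bullet> (H *v v) = v \<bullet> (H *v u)"
    and min: "\<And>t. 1/2 * (d \<bullet> (H *v d)) + r \<bullet> d
        \<le> 1/2 * ((d + t *\<^sub>R v) \<bullet> (H *v (d + t *\<^sub>R v))) + r \<bullet> (d + t *\<^sub>R v)"
  shows "(H *v d + r) \<bullet> v = 0"
proof (rule linear_coefficient_zero[where b = "1/2 * (v \<bullet> (H *v v))"])
  fix t :: real
  have "1/2 * ((d + t *\<^sub>R v) \<bullet> (H *v (d + t *\<^sub>R v))) + r \<bullet> (d + t *\<^sub>R v)
      = 1/2 * (d \<bullet> (H *v d)) + r \<bullet> d
        + (t * ((H *v d + r) \<bullet> v) + t\<^sup>2 * (1/2 * (v \<bullet> (H *v v))))"
    using sym[of d v]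
    by (simp add: matrix_vector_right_distrib matrix_vector_mult_scaleR inner_add_left
        inner_add_right inner_commute[of _ v] algebra_simps power2_eq_square)
  with min[of t] show "0 \<le> t * ((H *v d + r) \<bullet> v) + t\<^sup>2 * (1/2 * (v \<bullet> (H *v v)))"
    by simp
qed

theorem theorem1:
  fixes f :: "real^'n \<Rightarrow> real"
    and g :: "real^'n \<Rightarrow> ereal"
    and L\<^sub>f \<gamma> :: real
    and xhat dstar :: "real^'n"
    and H P Q Pperp LN :: "real^'n^'n"
  assumes "\<And>x. f differentiable (at x)"
    and "continuous_on UNIV (gradient f)"
    and "L\<^sub>f-lipschitz_on UNIV (gradient f)"
    and "proper_fun g" and "lower_semicont g" and "convex_fun g"
    and "\<exists>m::real. \<forall>x. ereal m \<le> ereal (f x) + g x"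
    and "\<gamma> > 0"
    and "H \<in> generalized_hessian f xhat"
    and "P \<in> clarke_jacobian (prox (\<lambda>u. ereal \<gamma> * g u)) (xhat - \<gamma> *\<^sub>R gradient f xhat)"
    and "Q = mat 1 - \<gamma> *\<^sub>R H"
    and "LN = (1 / \<gamma>) *\<^sub>R (mat 1 - P ** Q)"
    and "P ** P = P"
    and "Pperp = mat 1 - P"
    and "is_arg_min
           (\<lambda>d. 1/2 * (d \<bullet> (H *v d)) + fp_residual f g \<gamma> xhat \<bullet> d)
           (\<lambda>d. Pperp *v d = - (\<gamma> *\<^sub>R (Pperp *v fp_residual f g \<gamma> xhat)))
           dstar"
  shows "LN *v dstar = - fp_residual f g \<gamma> xhat"
proof -
  define R where "R = fp_residual f g \<gamma> xhat"
  have H_sym: "u \<bullet> (H *v v) = v \<bullet> (H *v u)" for u v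
    using generalized_hessian_selfadjoint[OF assms(1,9)] .
  have "1-lipschitz_on UNIV (prox (\<lambda>u. ereal \<gamma> * g u))"
    using assms(4-6,8)
    by (intro prox_nonexpansive proper_fun_scale lower_semicont_scale convex_fun_scale)
  then have "norm (P *v v) \<le> norm v" for v
    using clarke_jacobian_norm_le[OF _ assms(10), of 1] by simp
  moreover have P_idem: "P *v (P *v v) = P *v v" for v
    using \<open>P ** P = P\<close> by (simp add: matrix_vector_mul_assoc)
  ultimately have P_sym: "(P *v u) \<bullet> v = u \<bullet> (P *v v)" for u v
    by (intro nonexpansive_idempotent_selfadjoint) auto
  have Pperp: "Pperp *v v = v - P *v v" for v
    by (simp add: \<open>Pperp = mat 1 - P\<close> matrix_vector_mult_diff_rdistrib)
  have feasible: "dstar - P *v dstar = - (\<gamma> *\<^sub>R (R - P *v R))"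
    and min: "\<And>d. Pperp *v d = - (\<gamma> *\<^sub>R (Pperp *v R)) \<Longrightarrow>
        1/2 * (dstar \<bullet> (H *v dstar)) + R \<bullet> dstar \<le> 1/2 * (d \<bullet> (H *v d)) + R \<bullet> d"
    using assms(15) unfolding is_arg_min_linorder R_def[symmetric] by (auto simp: Pperp)
  \<comment> \<open>Moving along the range of \<open>P\<close> keeps the constraint, since \<open>Pperp\<close> annihilates that range.\<close>
  have "(H *v dstar + R) \<bullet> (P *v w) = 0" for w
  proof (rule quadratic_minimizer_stationary[OF H_sym])
    fix t :: real
    have "Pperp *v (dstar + t *\<^sub>R (P *v w)) = - (\<gamma> *\<^sub>R (Pperp *v R))"
      using feasible
      by (simp add: Pperp matrix_vector_right_distrib matrix_vector_mult_scaleR P_idem)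
    then show "1/2 * (dstar \<bullet> (H *v dstar)) + R \<bullet> dstar
        \<le> 1/2 * ((dstar + t *\<^sub>R (P *v w)) \<bullet> (H *v (dstar + t *\<^sub>R (P *v w))))
          + R \<bullet> (dstar + t *\<^sub>R (P *v w))"
      by (rule min)
  qed
  then have "(P *v (H *v dstar + R)) \<bullet> (P *v (H *v dstar + R)) = 0"
    by (simp add: P_sym P_idem)
  then have stationary: "P *v (H *v dstar) = - (P *v R)"
    by (simp add: matrix_vector_right_distrib eq_neg_iff_add_eq_0)
  have "LN *v dstar = (1 / \<gamma>) *\<^sub>R (dstar - P *v (dstar - \<gamma> *\<^sub>R (H *v dstar)))"
    by (simp add: assms(11,12) matrix_vector_mult_diff_rdistrib matrix_vector_mul_assoc[symmetric]
        flip: scaleR_matrix_vector_assoc)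
  also have "\<dots> = (1 / \<gamma>) *\<^sub>R (dstar - P *v dstar) + P *v (H *v dstar)"
    using \<open>\<gamma> > 0\<close>
    by (simp add: matrix_vector_mult_diff_distrib matrix_vector_mult_scaleR algebra_simps)
  also have "\<dots> = - R"
    using \<open>\<gamma> > 0\<close> unfolding feasible stationary by simp
  finally show ?thesis
    by (simp add: R_def)
qed

end
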